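(* Let $G$ be a bipartite graph with $q$ edges that admits an $\alpha$-labeling $f_G$ with characteristic $k_G$, and let $L_G=\{u\in V(G): f_G(u)\le k_G\}$ and $H_G=\{u\in V(G): f_G(u)>k_G\}$ be the stable sets it induces; identify each vertex of $G$ with its label under $f_G$. Let $n\ge 1$ and let $L,H\subset[0,n]$ be fixed disjoint sets. Let $\Gamma$ be a family of bipartite graphs such that every $F\in\Gamma$ has exactly $n$ edges and admits an $\alpha$-labeling $f_F$ whose characteristic induces stable sets that are mapped by $f_F$ onto $L$ (the lower set) and onto $H$ (the higher set), respectively, where $L$ and $H$ do not depend on $F$; identify each vertex of $F$ with its label under $f_F$, so that $V(F)=L\cup H$ for every $F\in\Gamma$. Let $h:E(G)\to\Gamma$ be any function. Then the graph $G\bar\otimes_h\Gamma$ admits an $\alpha$-labeling.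
   Context: For a graph $G$ with $q$ edges, a $\beta$-labeling (graceful labeling) is an injective map $f:V(G)\to[0,q]$ (integer interval) such that the edge labels $|f(u)-f(v)|$, $uv\in E(G)$, are pairwise distinct (hence form $[1,q]$). It is an $\alpha$-labeling if moreover there is an integer $k$ (the characteristic) with $\min\{f(u),f(v)\}\le k<\max\{f(u),f(v)\}$ for every edge $uv$; then $\{u: f(u)\le k\}$ and $\{u:f(u)>k\}$ are stable sets partitioning $V(G)$. The weak $\otimes_h$-product: given a bipartite graph $G$ with stable sets $L_G,H_G$, a family $\Gamma$ of bipartite graphs all having vertex set $L\cup H$ with stable sets $L$ and $H$, and a function $h:E(G)\to\Gamma$, the graph $G\bar\otimes_h\Gamma$ has vertex set $(L_G\times L)\cup(H_G\times H)$, and $(a,x)\in L_G\times L$ is adjacent to $(b,y)\in H_G\times H$ if and only if $ab\in E(G)$ and $xy\in E(h(ab))$.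
   Formalization: The graph G is required to have at least one edge (q ≥ 1); for q = 0 the claim fails, e.g. G a single vertex with label and characteristic 0, Γ = {path 0–2–1}, L = {0,1}, H = {2}: the product has two vertices and no edges. *)

theory Defs
  imports Main "HOL-Library.FuncSet"
begin

record 'a graph =
  verts :: "'a set"
  edges :: "'a set set"

definition simple_graph :: "'a graph \<Rightarrow> bool" where
  "simple_graph G \<longleftrightarrow> finite (verts G) \<and>
     (\<forall>e \<in> edges G. \<exists>u \<in> verts G. \<exists>v \<in> verts G. u \<noteq> v \<and> e = {u, v})"

definition stable_sets :: "'a graph \<Rightarrow> 'a set \<Rightarrow> 'a set \<Rightarrow> bool" where
  "stable_sets G A B \<longleftrightarrow> A \<union> B = verts G \<and> A \<inter> B = {} \<and>
     (\<forall>e \<in> edges G. \<exists>a \<in> A. \<exists>b \<in> B. e = {a, b})"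

definition bipartite :: "'a graph \<Rightarrow> bool" where
  "bipartite G \<longleftrightarrow> simple_graph G \<and> (\<exists>A B. stable_sets G A B)"

definition beta_labeling :: "'a graph \<Rightarrow> ('a \<Rightarrow> int) \<Rightarrow> bool" where
  "beta_labeling G f \<longleftrightarrow>
     inj_on f (verts G) \<and> f ` verts G \<subseteq> {0..int (card (edges G))} \<and>
     (\<forall>u v u' v'. {u, v} \<in> edges G \<longrightarrow> {u', v'} \<in> edges G \<longrightarrow>
        \<bar>f u - f v\<bar> = \<bar>f u' - f v'\<bar> \<longrightarrow> {u, v} = {u', v'})"

definition is_characteristic :: "'a graph \<Rightarrow> ('a \<Rightarrow> int) \<Rightarrow> int \<Rightarrow> bool" where
  "is_characteristic G f k \<longleftrightarrow>
     (\<forall>u v. {u, v} \<in> edges G \<longrightarrow> min (f u) (f v) \<le> k \<and> k < max (f u) (f v))"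

definition alpha_labeling :: "'a graph \<Rightarrow> ('a \<Rightarrow> int) \<Rightarrow> bool" where
  "alpha_labeling G f \<longleftrightarrow> beta_labeling G f \<and> (\<exists>k. is_characteristic G f k)"

definition lower_set :: "'a graph \<Rightarrow> ('a \<Rightarrow> int) \<Rightarrow> int \<Rightarrow> 'a set" where
  "lower_set G f k = {u \<in> verts G. f u \<le> k}"

definition higher_set :: "'a graph \<Rightarrow> ('a \<Rightarrow> int) \<Rightarrow> int \<Rightarrow> 'a set" where
  "higher_set G f k = {u \<in> verts G. k < f u}"

text \<open>The graph obtained by identifying each vertex with its label; it is used only for \<open>f\<close>
  injective on the vertices.\<close>

definition relabel :: "('a \<Rightarrow> 'b) \<Rightarrow> 'a graph \<Rightarrow> 'b graph" where
  "relabel f G = \<lparr>verts = f ` verts G, edges = (\<lambda>e. f ` e) ` edges G\<rparr>"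

text \<open>The product of \<open>G\<close>, with stable sets \<open>LG\<close> and \<open>HG\<close>, with a family of graphs whose stable
  sets are \<open>L\<close> and \<open>H\<close>. The family enters only through the graphs \<open>h e\<close> for edges \<open>e\<close> of \<open>G\<close>.\<close>

definition weak_product ::
  "'a graph \<Rightarrow> 'a set \<Rightarrow> 'a set \<Rightarrow> 'b set \<Rightarrow> 'b set \<Rightarrow> ('a set \<Rightarrow> 'b graph) \<Rightarrow> ('a \<times> 'b) graph"
where
  "weak_product G LG HG L H h =
     \<lparr>verts = (LG \<times> L) \<union> (HG \<times> H),
      edges = {{(a, x), (b, y)} | a x b y.
                 (a, x) \<in> LG \<times> L \<and> (b, y) \<in> HG \<times> H \<and>
                 {a, b} \<in> edges G \<and> {x, y} \<in> edges (h {a, b})}\<rparr>"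

lemma stable_sets_weak_product:
  assumes "LG \<inter> HG = {}"
  shows "stable_sets (weak_product G LG HG L H h) (LG \<times> L) (HG \<times> H)"
  using assms unfolding stable_sets_def weak_product_def by fastforce

lemma bipartite_weak_product:
  assumes "LG \<inter> HG = {}" "finite LG" "finite HG" "finite L" "finite H"
  shows "bipartite (weak_product G LG HG L H h)"
proof -
  let ?P = "weak_product G LG HG L H h"
  have st: "stable_sets ?P (LG \<times> L) (HG \<times> H)"
    by (rule stable_sets_weak_product[OF assms(1)])
  have "finite (verts ?P)"
    using assms by (simp add: weak_product_def)
  moreover have "\<exists>u \<in> verts ?P. \<exists>v \<in> verts ?P. u \<noteq> v \<and> e = {u, v}" if "e \<in> edges ?P" for e
  proof -
    have "\<forall>e \<in> edges ?P. \<exists>u \<in> LG \<times> L. \<exists>v \<in> HG \<times> H. e = {u, v}"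
      using st by (simp add: stable_sets_def)
    from bspec[OF this that] obtain u v where uv: "u \<in> LG \<times> L" "v \<in> HG \<times> H" "e = {u, v}"
      by (elim bexE)
    moreover have "u \<in> verts ?P" "v \<in> verts ?P"
      using uv by (simp_all add: weak_product_def)
    moreover have "u \<noteq> v"
      using uv assms(1) by auto
    ultimately show ?thesis by blast
  qed
  ultimately show ?thesis
    using st unfolding bipartite_def simple_graph_def by blast
qed

end

theory Submission imports Defs begin

text \<open>With vertices identified with their labels, label \<open>(a, x)\<close> in \<open>L\<^sub>G \<times> L\<close> by \<open>n a + x\<close> and
  \<open>(b, y)\<close> in \<open>H\<^sub>G \<times> H\<close> by \<open>n (b - 1) + y\<close>. An edge then gets \<open>n (b - a - 1) + (y - x)\<close> with
  \<open>y - x\<close> in \<open>[1, n]\<close>, so division with remainder recovers first the edge \<open>ab\<close> and then the edge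
  \<open>xy\<close> of \<open>h(ab)\<close>. If \<open>k\<close> is a characteristic of one \<open>F\<close> in \<open>\<Gamma>\<close>, then \<open>x \<le> k < y\<close> for
  all \<open>x\<close> in \<open>L\<close> and \<open>y\<close> in \<open>H\<close>, so \<open>L \<subseteq> [0, n - 1]\<close> and \<open>H \<subseteq> [1, n]\<close>; this makes the vertex
  labels distinct on each side, and \<open>n k\<^sub>G + k\<close> separates the two sides.\<close>

text \<open>Euclidean division with remainders in [1, m] instead of [0, m - 1]: subtracting 1 from
  \<open>r\<close> and \<open>r'\<close> reduces it to \<open>div\<close>. The bounds on
  \<open>r\<close> already force \<open>m\<close> to be positive.\<close>

lemma quot_rem_unique_pos:
  fixes m d d' r r' :: int
  assumes "m * d + r = m * d' + r'" "1 \<le> r" "r \<le> m" "1 \<le> r'" "r' \<le> m"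
  shows "d = d'" "r = r'"
proof -
  have "(m * d + (r - 1)) div m = d" "(m * d' + (r' - 1)) div m = d'"
    using assms by simp_all
  with assms(1) show "d = d'"
    by (simp add: algebra_simps)
  with assms(1) show "r = r'"
    by simp
qed

lemma edge_lower_higher:
  assumes "simple_graph G" "is_characteristic G f k" "e \<in> edges G"
  obtains a b where "e = {a, b}" "a \<in> lower_set G f k" "b \<in> higher_set G f k"
proof -
  obtain u v where uv: "u \<in> verts G" "v \<in> verts G" "e = {u, v}"
    using assms unfolding simple_graph_def by blast
  have "min (f u) (f v) \<le> k" "k < max (f u) (f v)"
    using assms uv unfolding is_characteristic_def by blast+
  then have "f u \<le> k \<and> k < f v \<or> f v \<le> k \<and> k < f u"
    by linarith
  then show ?thesis
    using uv that[of u v] that[of v u] by (auto simp: lower_set_def higher_set_def insert_commute)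
qed

lemma finite_edges: "simple_graph G \<Longrightarrow> finite (edges G)"
  unfolding simple_graph_def by (rule finite_subset[of _ "Pow (verts G)"]) auto

lemma card_edges_relabel:
  assumes "simple_graph G" "inj_on f (verts G)"
  shows "card (edges (relabel f G)) = card (edges G)"
proof -
  have "\<Union> (edges G) \<subseteq> verts G"
    using assms(1) unfolding simple_graph_def by auto
  then have "inj_on ((`) f) (edges G)"
    by (intro inj_on_image inj_on_subset[OF assms(2)])
  then show ?thesis
    by (simp add: relabel_def card_image)
qed

text \<open>Every edge of the relabelled graph is the \<open>f\<close>-image of an edge of
  \<open>G\<close> with the same absolute difference, so the identity inherits from \<open>f\<close>
  that edge labels are distinct.\<close>

lemma relabel_edges_distinct:
  assumes "beta_labeling G f" "simple_graph G"
    and "{x, y} \<in> edges (relabel f G)" "{x', y'} \<in> edges (relabel f G)"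
    and "\<bar>x - y\<bar> = \<bar>x' - y'\<bar>"
  shows "{x, y} = {x', y'}"
proof -
  have *: "\<exists>u v. {u, v} \<in> edges G \<and> {z, w} = {f u, f v} \<and> \<bar>z - w\<bar> = \<bar>f u - f v\<bar>"
    if zw: "{z, w} \<in> edges (relabel f G)" for z w
  proof -
    obtain e where "e \<in> edges G" "{z, w} = f ` e"
      using zw by (auto simp: relabel_def)
    moreover from this obtain u v where "e = {u, v}"
      using assms(2) unfolding simple_graph_def by blast
    ultimately show ?thesis
      by (intro exI[of _ u] exI[of _ v]) (auto simp: doubleton_eq_iff)
  qed
  obtain u v u' v' where "{u, v} \<in> edges G" "{x, y} = {f u, f v}" "\<bar>x - y\<bar> = \<bar>f u - f v\<bar>"
    "{u', v'} \<in> edges G" "{x', y'} = {f u', f v'}" "\<bar>x' - y'\<bar> = \<bar>f u' - f v'\<bar>"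
    using *[OF assms(3)] *[OF assms(4)] by blast
  moreover from this have "{u, v} = {u', v'}"
    using assms(1,5) unfolding beta_labeling_def by metis
  then have "f ` {u, v} = f ` {u', v'}"
    by simp
  ultimately show ?thesis
    by simp
qed

text \<open>An edge \<open>P\<close> of the product is sent onto the pair of edges \<open>fst ` P\<close>, \<open>snd ` P\<close>.\<close>

lemma card_edges_weak_product_ge:
  assumes "finite LG" "finite HG" "finite L" "finite H" "finite (edges G)"
    and G: "\<And>e. e \<in> edges G \<Longrightarrow> \<exists>a \<in> LG. \<exists>b \<in> HG. e = {a, b}"
    and h: "\<And>e d. e \<in> edges G \<Longrightarrow> d \<in> edges (h e) \<Longrightarrow> \<exists>x \<in> L. \<exists>y \<in> H. d = {x, y}"
    and n: "\<And>e. e \<in> edges G \<Longrightarrow> card (edges (h e)) = n"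
  shows "n * card (edges G) \<le> card (edges (weak_product G LG HG L H h))"
proof -
  let ?P = "weak_product G LG HG L H h"
  have fin: "finite (edges ?P)"
    by (rule finite_subset[of _ "Pow (LG \<times> L \<union> HG \<times> H)"])
      (use assms(1-4) in \<open>auto simp: weak_product_def\<close>)
  have fin': "finite (edges (h e))" if "e \<in> edges G" for e
    by (rule finite_subset[of _ "Pow (L \<union> H)"])
      (use assms(3,4) h[OF that] in \<open>fastforce+\<close>)
  have "(SIGMA e:edges G. edges (h e)) \<subseteq> (\<lambda>P. (fst ` P, snd ` P)) ` edges ?P"
  proof clarify
    fix e d assume ed: "e \<in> edges G" "d \<in> edges (h e)"
    obtain a b where ab: "a \<in> LG" "b \<in> HG" "e = {a, b}"
      using G[OF ed(1)] by blast
    obtain x y where xy: "x \<in> L" "y \<in> H" "d = {x, y}"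
      using h[OF ed] by blast
    \<comment> \<open>Pairing lower ends with lower ends and higher with higher gives a preimage of
      \<open>(e, d)\<close>.\<close>
    have "{(a, x), (b, y)} \<in> edges ?P"
      using ed ab xy unfolding weak_product_def by auto
    then show "(e, d) \<in> (\<lambda>P. (fst ` P, snd ` P)) ` edges ?P"
      by (rule rev_image_eqI) (use ab xy in simp)
  qed
  then have "card (SIGMA e:edges G. edges (h e)) \<le> card (edges ?P)"
    using fin by (rule surj_card_le[rotated])
  then show ?thesis
    using assms(5) fin' n by (simp add: mult.commute)
qed

theorem theorem4:
  fixes G :: "'a graph" and q :: nat and fG :: "'a \<Rightarrow> int" and kG :: int
    and n :: nat and L H :: "int set"
    and \<Gamma> :: "'b graph set" and f :: "'b graph \<Rightarrow> 'b \<Rightarrow> int"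
    and h :: "'a set \<Rightarrow> 'b graph"
  assumes "bipartite G" and "card (edges G) = q" and "q \<ge> 1"
    and "alpha_labeling G fG" and "is_characteristic G fG kG"
    and "n \<ge> 1"
    and "L \<subseteq> {0..int n}" and "H \<subseteq> {0..int n}" and "L \<inter> H = {}"
    and "\<And>F. F \<in> \<Gamma> \<Longrightarrow> bipartite F"
    and "\<And>F. F \<in> \<Gamma> \<Longrightarrow> card (edges F) = n"
    and "\<And>F. F \<in> \<Gamma> \<Longrightarrow> alpha_labeling F (f F)"
    and "\<And>F. F \<in> \<Gamma> \<Longrightarrow> \<exists>k. is_characteristic F (f F) k \<and>
           f F ` lower_set F (f F) k = L \<and> f F ` higher_set F (f F) k = H"
    and "h \<in> edges G \<rightarrow> \<Gamma>"
  shows "\<exists>g. alpha_labeling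
           (weak_product G (lower_set G fG kG) (higher_set G fG kG) L H
              (\<lambda>e. relabel (f (h e)) (h e))) g"
proof -
  let ?LG = "lower_set G fG kG" and ?HG = "higher_set G fG kG"
  let ?R = "\<lambda>e. relabel (f (h e)) (h e)"
  let ?P = "weak_product G ?LG ?HG L H ?R"
  have sG: "simple_graph G" and bG: "beta_labeling G fG"
    using assms(1,4) by (auto simp: bipartite_def alpha_labeling_def)
  have h: "h e \<in> \<Gamma>" if "e \<in> edges G" for e
    using assms(14) that by blast
  have sF: "simple_graph F" and bF: "beta_labeling F (f F)" if "F \<in> \<Gamma>" for F
    using assms(10,12)[OF that] by (auto simp: bipartite_def alpha_labeling_def)
  have fG: "0 \<le> fG a" "fG a \<le> int q" if "a \<in> verts G" for a
    using bG that assms(2) unfolding beta_labeling_def by force+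

  have "edges G \<noteq> {}"
    using assms(2,3) by auto
  then obtain e0 where e0: "e0 \<in> edges G"
    by blast
  have kG: "0 \<le> kG" "kG < int q"
    by (rule edge_lower_higher[OF sG assms(5) e0],
        use fG in \<open>force simp: lower_set_def higher_set_def\<close>)+
  have edgeR: "\<exists>x \<in> L. \<exists>y \<in> H. d = {x, y}" if e: "e \<in> edges G" and d: "d \<in> edges (?R e)" for e d
  proof -
    obtain k where k: "is_characteristic (h e) (f (h e)) k"
      "f (h e) ` lower_set (h e) (f (h e)) k = L" "f (h e) ` higher_set (h e) (f (h e)) k = H"
      using assms(13)[OF h[OF e]] by blast
    obtain c where c: "c \<in> edges (h e)" "d = f (h e) ` c"
      using d by (auto simp: relabel_def)
    obtain a b where "c = {a, b}" "a \<in> lower_set (h e) (f (h e)) k"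
      "b \<in> higher_set (h e) (f (h e)) k"
      by (rule edge_lower_higher[OF sF[OF h[OF e]] k(1) c(1)])
    then show ?thesis
      using c(2) k(2,3) by blast
  qed
  have cardR: "card (edges (?R e)) = n" if "e \<in> edges G" for e
  proof -
    have "inj_on (f (h e)) (verts (h e))"
      using bF[OF h[OF that]] by (simp add: beta_labeling_def)
    from card_edges_relabel[OF sF[OF h[OF that]] this] show ?thesis
      using assms(11)[OF h[OF that]] by simp
  qed
  \<comment> \<open>A characteristic of the single graph \<open>h e0\<close> suffices:
    \<open>L\<close> and \<open>H\<close> are common to the whole family, so this \<open>k\<close>
    separates them once and for all.\<close>
  obtain k where kL: "\<And>x. x \<in> L \<Longrightarrow> x \<le> k" and kH: "\<And>y. y \<in> H \<Longrightarrow> k < y"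
    using assms(13)[OF h[OF e0]] by (fastforce simp: lower_set_def higher_set_def)
  \<comment> \<open>Since n is at least 1, some edge exists; its ends witness that \<open>L\<close>
    and \<open>H\<close> are nonempty, which traps \<open>k\<close> in [0, n - 1].\<close>
  have "edges (?R e0) \<noteq> {}"
    using cardR[OF e0] assms(6) by auto
  then obtain x0 y0 where "x0 \<in> L" "y0 \<in> H"
    using edgeR[OF e0] by blast
  then have k: "0 \<le> k" "k < int n"
    using kL kH assms(7,8) by force+
  have L: "0 \<le> x" "x < int n" if "x \<in> L" for x
    using that kL[OF that] k assms(7) by auto
  have H: "1 \<le> y" "y \<le> int n" if "y \<in> H" for y
    using that kH[OF that] k assms(8) by auto

  \<comment> \<open>The shift \<open>fG a - 1\<close> on the higher side compensates for
    \<open>y - x\<close> starting at 1: as b - a runs over [1, q], the edge labels stay within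
    [1, n q].\<close>
  define g where
    "g = (\<lambda>(a, x). if fG a \<le> kG then int n * fG a + x else int n * (fG a - 1) + x)"
  have low: "g (a, x) = int n * fG a + x" "0 \<le> g (a, x)" "g (a, x) \<le> int n * kG + k"
    if "a \<in> ?LG" "x \<in> L" for a x
  proof -
    have a: "fG a \<le> kG" "0 \<le> fG a"
      using that fG by (auto simp: lower_set_def)
    then show eq: "g (a, x) = int n * fG a + x"
      by (simp add: g_def)
    have "int n * fG a \<le> int n * kG" "0 \<le> int n * fG a"
      using a by (simp_all add: mult_left_mono)
    then show "0 \<le> g (a, x)" "g (a, x) \<le> int n * kG + k"
      unfolding eq using L[OF that(2)] kL[OF that(2)] by linarith+
  qed
  have high: "g (b, y) = int n * (fG b - 1) + y" "g (b, y) \<le> int n * int q"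
    "int n * kG + k < g (b, y)"
    if "b \<in> ?HG" "y \<in> H" for b y
  proof -
    have b: "kG \<le> fG b - 1" "fG b - 1 \<le> int q - 1"
      using that(1) fG[of b] by (simp_all add: higher_set_def)
    then show eq: "g (b, y) = int n * (fG b - 1) + y"
      by (simp add: g_def)
    \<comment> \<open>After the shift \<open>fG b - 1\<close> may equal \<open>kG\<close>; the
      strict gap then comes from \<open>k < y\<close>.\<close>
    have "int n * kG \<le> int n * (fG b - 1)"
      by (rule mult_left_mono[OF b(1)]) simp
    then show "int n * kG + k < g (b, y)"
      unfolding eq using kH[OF that(2)] by linarith
    have "int n * (fG b - 1) \<le> int n * (int q - 1)"
      by (rule mult_left_mono[OF b(2)]) simp
    also have "\<dots> = int n * int q - int n"
      by (simp add: right_diff_distrib)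
    finally show "g (b, y) \<le> int n * int q"
      unfolding eq using H[OF that(2)] by linarith
  qed
  \<comment> \<open>The threshold lies in [0, n q], which supplies the upper bound for lower labels
    and the lower bound for higher ones.\<close>
  have bd: "0 \<le> int n * kG + k" "int n * kG + k \<le> int n * int q"
  proof -
    have "int n * kG \<le> int n * (int q - 1)"
      using kG by (intro mult_left_mono) auto
    also have "\<dots> = int n * int q - int n"
      by (simp add: right_diff_distrib)
    finally show "int n * kG + k \<le> int n * int q"
      using k by linarith
    show "0 \<le> int n * kG + k"
      using k kG by simp
  qed
  have vP: "verts ?P = ?LG \<times> L \<union> ?HG \<times> H"
    by (simp add: weak_product_def)
  \<comment> \<open>Edges are unordered, so each is oriented from its lower to its higher end; this
    resolves the absolute value, \<open>min\<close> and \<open>max\<close> at once.\<close>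
  have edgeP: "\<exists>a x b y. {u, v} = {(a, x), (b, y)} \<and> a \<in> ?LG \<and> x \<in> L \<and> b \<in> ?HG \<and> y \<in> H \<and>
      {a, b} \<in> edges G \<and> {x, y} \<in> edges (?R {a, b}) \<and> \<bar>g u - g v\<bar> = g (b, y) - g (a, x) \<and>
      min (g u) (g v) = g (a, x) \<and> max (g u) (g v) = g (b, y)"
    if uv: "{u, v} \<in> edges ?P" for u v
  proof -
    obtain a x b y where *: "{u, v} = {(a, x), (b, y)}" "a \<in> ?LG" "x \<in> L" "b \<in> ?HG" "y \<in> H"
      "{a, b} \<in> edges G" "{x, y} \<in> edges (?R {a, b})"
      using uv unfolding weak_product_def by auto
    moreover have "g (a, x) < g (b, y)"
      using low(3)[OF *(2,3)] high(3)[OF *(4,5)] by linarith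
    ultimately show ?thesis
      by (intro exI[of _ a] exI[of _ x] exI[of _ b] exI[of _ y]) (auto simp: doubleton_eq_iff)
  qed

  have "inj_on g (verts ?P)"
  proof (rule inj_onI)
    have vert_eq: "a = a'" if "a \<in> verts G" "a' \<in> verts G" "fG a = fG a'" for a a'
      using bG that unfolding beta_labeling_def inj_on_def by blast
    fix u v assume "u \<in> verts ?P" "v \<in> verts ?P" and eq: "g u = g v"
    moreover obtain a x b y where uv: "u = (a, x)" "v = (b, y)"
      by (cases u, cases v)
    ultimately consider (both_low) "a \<in> ?LG" "x \<in> L" "b \<in> ?LG" "y \<in> L"
      | (both_high) "a \<in> ?HG" "x \<in> H" "b \<in> ?HG" "y \<in> H"
      using low(3)[of a x] low(3)[of b y] high(3)[of a x] high(3)[of b y] unfolding vP by auto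
    then show "u = v"
    proof cases
      case both_low
      \<comment> \<open>Adding 1 moves the remainders from [0, n - 1] to [1, n].\<close>
      then have "int n * fG a + (x + 1) = int n * fG b + (y + 1)"
        using eq uv low(1) by simp
      from quot_rem_unique_pos[OF this] show ?thesis
        using L[OF both_low(2)] L[OF both_low(4)] both_low uv vert_eq by (simp add: lower_set_def)
    next
      case both_high
      then have "int n * (fG a - 1) + x = int n * (fG b - 1) + y"
        using eq uv high(1) by simp
      from quot_rem_unique_pos[OF this] show ?thesis
        using H[OF both_high(2)] H[OF both_high(4)] both_high uv vert_eq by (simp add: higher_set_def)
    qed
  qed
  moreover have "g ` verts ?P \<subseteq> {0..int (card (edges ?P))}"
  proof -
    have fin: "finite ?LG" "finite ?HG" "finite L" "finite H"
      using sG assms(7,8) finite_subset[OF _ finite_atLeastAtMost_int]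
      by (auto simp: simple_graph_def lower_set_def higher_set_def)
    have edgeG: "\<exists>a \<in> ?LG. \<exists>b \<in> ?HG. e = {a, b}" if "e \<in> edges G" for e
      using edge_lower_higher[OF sG assms(5) that] by blast
    \<comment> \<open>Vertex labels are at most n q, so a lower bound on the number of product edges
      is enough.\<close>
    have "n * card (edges G) \<le> card (edges ?P)"
      by (rule card_edges_weak_product_ge[OF fin finite_edges[OF sG]])
        (use edgeG edgeR cardR in blast)+
    then have "int n * int q \<le> int (card (edges ?P))"
      by (metis assms(2) of_nat_le_iff of_nat_mult)
    then show ?thesis
      using low(2,3) high(2,3) bd by (fastforce simp: vP)
  qed
  moreover have "{u, v} = {u', v'}"
    if uv: "{u, v} \<in> edges ?P" "{u', v'} \<in> edges ?P" and eq: "\<bar>g u - g v\<bar> = \<bar>g u' - g v'\<bar>"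
    for u v u' v'
  proof -
    obtain a x b y where 1: "{u, v} = {(a, x), (b, y)}" "a \<in> ?LG" "x \<in> L" "b \<in> ?HG" "y \<in> H"
      "{a, b} \<in> edges G" "{x, y} \<in> edges (?R {a, b})" "\<bar>g u - g v\<bar> = g (b, y) - g (a, x)"
      using edgeP[OF uv(1)] by blast
    obtain a' x' b' y' where 2: "{u', v'} = {(a', x'), (b', y')}"
      "a' \<in> ?LG" "x' \<in> L" "b' \<in> ?HG" "y' \<in> H" "{a', b'} \<in> edges G"
      "{x', y'} \<in> edges (?R {a', b'})" "\<bar>g u' - g v'\<bar> = g (b', y') - g (a', x')"
      using edgeP[OF uv(2)] by blast
    have xy: "x < y" "x' < y'" and ab: "fG a < fG b" "fG a' < fG b'"
      using kL[OF 1(3)] kH[OF 1(5)] kL[OF 2(3)] kH[OF 2(5)] 1(2,4) 2(2,4)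
      by (auto simp: lower_set_def higher_set_def)
    have "int n * (fG b - fG a - 1) + (y - x) = int n * (fG b' - fG a' - 1) + (y' - x')"
      using eq 1(8) 2(8) low(1)[OF 1(2,3)] high(1)[OF 1(4,5)] low(1)[OF 2(2,3)] high(1)[OF 2(4,5)]
      by (simp add: algebra_simps)
    note quot_rem_unique_pos[OF this]
    then have d: "fG b - fG a = fG b' - fG a'" "y - x = y' - x'"
      using xy L[OF 1(3)] L[OF 2(3)] H[OF 1(5)] H[OF 2(5)] by simp_all
    \<comment> \<open>Equal quotients give the same edge of \<open>G\<close>, hence the same value
      of \<open>h\<close>; only then can equal remainders be compared inside one graph of the
      family.\<close>
    have "\<bar>fG a - fG b\<bar> = \<bar>fG a' - fG b'\<bar>"
      using d(1) ab by simp
    with bG 1(6) 2(6) have e: "{a, b} = {a', b'}"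
      unfolding beta_labeling_def by blast
    have "\<bar>x - y\<bar> = \<bar>x' - y'\<bar>"
      using d(2) xy by simp
    with relabel_edges_distinct[OF bF sF, OF h h, OF 1(6) 1(6)] 1(7) 2(7)
    have "{x, y} = {x', y'}"
      unfolding e by blast
    \<comment> \<open>The inequalities in \<open>ab\<close> and \<open>xy\<close> exclude the
      swapped matchings of the ends.\<close>
    with e xy ab d have "a = a'" "b = b'" "x = x'" "y = y'"
      by (auto simp: doubleton_eq_iff)
    then show ?thesis
      using 1(1) 2(1) by simp
  qed
  ultimately have "beta_labeling ?P g"
    unfolding beta_labeling_def by blast
  moreover have "is_characteristic ?P g (int n * kG + k)"
    unfolding is_characteristic_def
  proof (intro allI impI)
    fix u v assume "{u, v} \<in> edges ?P"
    from edgeP[OF this] obtain a x b y where "a \<in> ?LG" "x \<in> L" "b \<in> ?HG" "y \<in> H"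
      "min (g u) (g v) = g (a, x)" "max (g u) (g v) = g (b, y)"
      by blast
    then show "min (g u) (g v) \<le> int n * kG + k \<and> int n * kG + k < max (g u) (g v)"
      using low(3) high(3) by simp
  qed
  ultimately show ?thesis
    unfolding alpha_labeling_def by blast
qed

end
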